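(* Let $\mathbf E=(E,+,{}',0,1)$ be a monotonous effect algebra with induced order $\leq$. Let $\mathbb C(\mathbf E)=(E,\leq,\odot,\rightarrow,{}',0,1)$ where $x\odot y:=(x'+y')'$ (defined iff $x'\leq y$) and $x\rightarrow y:=\{x'+u\mid u\in L(x,y)\}$, and let $\mathbb E(\mathbb C(\mathbf E))=(E,\oplus,{}',0,1)$ where $x\oplus y:=(x'\odot y')'$, defined if and only if $x\leq y'$. Then $\mathbb E(\mathbb C(\mathbf E))=\mathbf E$, i.e. for all $a,b\in E$, $a\oplus b$ is defined iff $a+b$ is defined, and in this case $a\oplus b=a+b$.
   Context: An effect algebra is a partial algebra $(E,+,{}',0,1)$ of type $(2,1,0,0)$ where $(E,{}',0,1)$ is an algebra and $+$ is a partial binary operation such that for all $x,y,z\in E$: (E1) $x+y$ is defined iff $y+x$ is defined, and then $x+y=y+x$; (E2) $(x+y)+z$ is defined iff $x+(y+z)$ is defined, and then they are equal; (E3) $x'$ is the unique $u\in E$ with $x+u=1$; (E4) if $1+x$ is defined then $x=0$. The induced order is $x\leq y$ iff there is $z\in E$ with $x+z=y$. For a poset and $A\subseteq E$: $L(A)=\{x\mid x\leq y\ \forall y\in A\}$, $U(A)=\{x\mid y\leq x\ \forall y\in A\}$, $L(a,b)=L(\{a,b\})$. For subsets $A,B$, $A\leq B$ means $x\leq y$ for all $x\in A,y\in B$; $x+A=\{x+y\mid y\in A\}$. The effect algebra is monotonous if for all $x\in E$ and all non-empty $A,B\subseteq E$: $A\cup B\leq x'$ and $L(A)\leq U(B)$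 imply $L(x+A)\leq U(x+B)$. *)

theory Defs
  imports Main
begin

text \<open>
  Structures \<open>(E, +, ', 0, 1)\<close> whose underlying set is the type \<open>'a\<close>. A partial operation is
  an option-valued function; \<open>None\<close> means ``undefined''.
\<close>

record 'a partial_algebra =
  plus :: "'a \<Rightarrow> 'a \<Rightarrow> 'a option"
  compl :: "'a \<Rightarrow> 'a"
  zero :: 'a
  one :: 'a

text \<open>
  Equality of option values is Kleene equality: both sides are undefined, or both are defined
  and equal. So axioms \<open>E1\<close> and \<open>E2\<close> include the equivalence of definedness.
\<close>

locale effect_algebra =
  fixes E :: "'a partial_algebra"
  assumes E1: "plus E x y = plus E y x"
    and E2: "Option.bind (plus E x y) (\<lambda>s. plus E s z) = Option.bind (plus E y z) (\<lambda>t. plus E x t)"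
    and E3: "plus E x u = Some (one E) \<longleftrightarrow> u = compl E x"
    and E4: "plus E (one E) x \<noteq> None \<Longrightarrow> x = zero E"

definition induced_le :: "'a partial_algebra \<Rightarrow> 'a \<Rightarrow> 'a \<Rightarrow> bool" where
  "induced_le E x y \<longleftrightarrow> (\<exists>z. plus E x z = Some y)"

definition lower :: "('a \<Rightarrow> 'a \<Rightarrow> bool) \<Rightarrow> 'a set \<Rightarrow> 'a set" where
  "lower le A = {x. \<forall>y\<in>A. le x y}"

definition upper :: "('a \<Rightarrow> 'a \<Rightarrow> bool) \<Rightarrow> 'a set \<Rightarrow> 'a set" where
  "upper le A = {x. \<forall>y\<in>A. le y x}"

definition set_le :: "('a \<Rightarrow> 'a \<Rightarrow> bool) \<Rightarrow> 'a set \<Rightarrow> 'a set \<Rightarrow> bool" where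
  "set_le le A B \<longleftrightarrow> (\<forall>x\<in>A. \<forall>y\<in>B. le x y)"

text \<open>
  The set \<open>x + A\<close>. It is only used when \<open>y \<le> x'\<close> for all \<open>y \<in> A\<close>, where every sum \<open>x + y\<close>
  is defined in an effect algebra.
\<close>

definition translate :: "'a partial_algebra \<Rightarrow> 'a \<Rightarrow> 'a set \<Rightarrow> 'a set" where
  "translate E x A = {z. \<exists>y\<in>A. plus E x y = Some z}"

locale monotonous_effect_algebra = effect_algebra E for E :: "'a partial_algebra" +
  assumes monotonous:
    "\<lbrakk>A \<noteq> {}; B \<noteq> {};
      set_le (induced_le E) (A \<union> B) {compl E x};
      set_le (induced_le E) (lower (induced_le E) A) (upper (induced_le E) B)\<rbrakk>
     \<Longrightarrow> set_le (induced_le E) (lower (induced_le E) (translate E x A))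
                              (upper (induced_le E) (translate E x B))"

text \<open>Structures \<open>(E, \<le>, \<odot>, \<rightarrow>, ', 0, 1)\<close> with partial \<open>\<odot>\<close> and set-valued \<open>\<rightarrow>\<close>.\<close>

record 'a residuated_structure =
  res_le :: "'a \<Rightarrow> 'a \<Rightarrow> bool"
  res_mult :: "'a \<Rightarrow> 'a \<Rightarrow> 'a option"
  res_imp :: "'a \<Rightarrow> 'a \<Rightarrow> 'a set"
  res_compl :: "'a \<Rightarrow> 'a"
  res_zero :: 'a
  res_one :: 'a

text \<open>
  In the next two definitions the side condition alone decides where the operation is
  defined. The term \<open>the None\<close> could occur only if the inner operation were undefined although
  the side condition holds, which is impossible when \<open>E\<close> is an effect algebra and, in the
  second definition, \<open>C\<close> is \<open>residuated_of E\<close>.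
\<close>

definition residuated_of :: "'a partial_algebra \<Rightarrow> 'a residuated_structure" where
  "residuated_of E =
     \<lparr>res_le = induced_le E,
      res_mult = (\<lambda>x y. if induced_le E (compl E x) y
                        then Some (compl E (the (plus E (compl E x) (compl E y))))
                        else None),
      res_imp = (\<lambda>x y. translate E (compl E x) (lower (induced_le E) {x, y})),
      res_compl = compl E,
      res_zero = zero E,
      res_one = one E\<rparr>"

definition effect_of :: "'a residuated_structure \<Rightarrow> 'a partial_algebra" where
  "effect_of C =
     \<lparr>plus = (\<lambda>x y. if res_le C x (res_compl C y)
                    then Some (res_compl C (the (res_mult C (res_compl C x) (res_compl C y))))
                    else None),
      compl = res_compl C,
      zero = res_zero C,
      one = res_one C\<rparr>"

end

theory Submission imports Defs begin

text \<open>Since complementation is an involution, unfolding both constructions gives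
  \<open>(x'' + y'')'' = x + y\<close> wherever the guards hold. It remains to match the domains:
  \<open>x \<le> y'\<close> must mean exactly that \<open>x + y\<close> is defined, which is
  \<open>induced_le_compl_iff\<close>.\<close>

context effect_algebra
begin

lemma compl_compl [simp]: "compl E (compl E x) = x"
  by (metis E1 E3)

lemma induced_le_compl_iff: "induced_le E x (compl E y) \<longleftrightarrow> plus E x y \<noteq> None"
proof
  assume "induced_le E x (compl E y)"
  then obtain z where "plus E x z = Some (compl E y)"
    by (auto simp: induced_le_def)
  \<comment> \<open>Reassociating \<open>y + (x + z) = y + y' = 1\<close> forces
    \<open>y + x\<close> to be defined.\<close>
  then have "Option.bind (plus E y x) (\<lambda>s. plus E s z) = Some (one E)"
    using E2[of y x z] E3 by simp
  then show "plus E x y \<noteq> None"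
    using E1[of x y] by (auto simp: bind_eq_Some_conv)
next
  assume "plus E x y \<noteq> None"
  then obtain s where "plus E y x = Some s"
    using E1[of x y] by auto
  \<comment> \<open>Reassociating \<open>(y + x) + s' = 1\<close> gives
    \<open>y + (x + s') = 1\<close>; by uniqueness of complements \<open>x + s' = y'\<close>, so
    \<open>s'\<close> witnesses \<open>x \<le> y'\<close>.\<close>
  then have "Option.bind (plus E x (compl E s)) (plus E y) = Some (one E)"
    using E2[of y x "compl E s"] E3[of s "compl E s"] by simp
  then show "induced_le E x (compl E y)"
    by (auto simp: induced_le_def bind_eq_Some_conv E3)
qed

lemma effect_of_residuated_of: "effect_of (residuated_of E) = E"
proof -
  have "plus (effect_of (residuated_of E)) = plus E"
    \<comment> \<open>The inner guard \<open>x'' \<le> y'\<close> is the outer one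
      \<open>x \<le> y'\<close>, so \<open>the\<close> is only applied to defined values.\<close>
    by (intro ext) (auto simp: effect_of_def residuated_of_def induced_le_compl_iff)
  then show ?thesis
    by (simp add: effect_of_def residuated_of_def)
qed

end

theorem theorem3:
  fixes E :: "'a partial_algebra"
  assumes "monotonous_effect_algebra E"
  shows "effect_of (residuated_of E) = E \<and>
    (\<forall>a b. (plus (effect_of (residuated_of E)) a b \<noteq> None \<longleftrightarrow> plus E a b \<noteq> None) \<and>
           (plus E a b \<noteq> None \<longrightarrow>
              the (plus (effect_of (residuated_of E)) a b) = the (plus E a b)))"
proof -
  interpret monotonous_effect_algebra E by fact
  show ?thesis by (simp add: effect_of_residuated_of)
qed

end
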